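(* Let $d>0$, let $I=[a,b]$ with $\ell(I)=b-a\ge 2d$, and let $f:I\to\mathbb{R}$ be a bounded function. Then the $d$-variation function ${}_{d}v_f$ of $f$ is $d$-periodically increasing on $I$.
   Context: A function $h:I\to\mathbb{R}$ is $d$-periodically increasing if $h(x)\le h(y)$ for all $x,y\in I$ with $y-x\ge d$. For an interval $[s,t]$ with $t-s\ge d$, put $V_{d,[s,t]}(f)=\sup_P\sum_{i=1}^n|f(x_i)-f(x_{i-1})|$, the supremum being over all partitions $P=\{s=x_0<\cdots<x_n=t\}$ with $x_i-x_{i-1}\ge d$ for all $i\in\{1,\dots,n\}$ (total $d$-variation). The $d$-variation function of $f$ is $${}_{d}v_f(x)=\begin{cases}0,& x\in[a,a+d),\\ V_{d,[a,x]}(f),& x\in[a+d,b].\end{cases}$$ *)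

theory Defs
  imports "HOL-Analysis.Analysis"
begin

definition d_periodically_increasing :: "real \<Rightarrow> real set \<Rightarrow> (real \<Rightarrow> real) \<Rightarrow> bool" where
  "d_periodically_increasing d I h \<longleftrightarrow> (\<forall>x\<in>I. \<forall>y\<in>I. y - x \<ge> d \<longrightarrow> h x \<le> h y)"

(* The partition s = p 0 < ... < p n = t is given by n and the values of p on {0..n};
   p is unconstrained beyond n. *)
definition d_partition :: "real \<Rightarrow> real \<Rightarrow> real \<Rightarrow> nat \<Rightarrow> (nat \<Rightarrow> real) \<Rightarrow> bool" where
  "d_partition d s t n p \<longleftrightarrow>
     p 0 = s \<and> p n = t \<and> (\<forall>i\<in>{1..n}. p (i - 1) < p i \<and> p i - p (i - 1) \<ge> d)"

(* Only meaningful for d > 0, t - s >= d and f bounded on {s..t}: then the set below is nonempty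
   and bounded above (n is at most (t - s) / d), so the real-valued Sup is the true supremum. *)
definition total_d_variation :: "real \<Rightarrow> real \<Rightarrow> real \<Rightarrow> (real \<Rightarrow> real) \<Rightarrow> real" where
  "total_d_variation d s t f =
     Sup {(\<Sum>i=1..n. \<bar>f (p i) - f (p (i - 1))\<bar>) | n p. d_partition d s t n p}"

(* Functions on the interval {a..b} are represented by total functions; only arguments x in
   {a..b} matter, so the right end point b is not a parameter. *)
definition d_variation_function :: "real \<Rightarrow> real \<Rightarrow> (real \<Rightarrow> real) \<Rightarrow> real \<Rightarrow> real" where
  "d_variation_function d a f x = (if x \<in> {a..<a + d} then 0 else total_d_variation d a x f)"

end

theory Submission imports Defs begin

text \<open>A partition of \<open>[a,x]\<close> extends to one of \<open>[a,y]\<close> by appending \<open>y\<close> when \<open>y - x \<ge> d\<close>, which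
  adds a nonnegative term to the variation sum. Boundedness of \<open>f\<close> makes the suprema finite, because
  a partition of \<open>[a,y]\<close> has at most \<open>(y - a) / d\<close> steps.\<close>

text \<open>Telescoping: each of the \<open>j - i\<close> steps contributes at least
  \<open>d\<close>. Taking \<open>i = 0\<close> or \<open>j = n\<close> keeps all points inside
  \<open>[s,t]\<close>; taking both bounds the number of steps.\<close>

lemma d_partition_gap:
  assumes "d_partition d s t n p" "i \<le> j" "j \<le> n"
  shows "p j - p i \<ge> real (j - i) * d"
  using assms(2,3)
proof (induction j rule: dec_induct)
  case base
  show ?case by simp
next
  case (step j)
  have "p (Suc j) - p j \<ge> d"
    using assms(1) step.prems unfolding d_partition_def by (auto dest: bspec[of _ _ "Suc j"])
  with step show ?case
    by (simp add: Suc_diff_le algebra_simps)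
qed

lemma d_partition_mem:
  assumes "d > 0" "d_partition d s t n p" "i \<le> n"
  shows "p i \<in> {s..t}"
proof -
  have "p 0 = s" "p n = t" using assms(2) by (auto simp: d_partition_def)
  moreover have "0 \<le> real (i - 0) * d" "0 \<le> real (n - i) * d" using assms(1) by auto
  ultimately show ?thesis
    using d_partition_gap[OF assms(2), of 0 i] d_partition_gap[OF assms(2), of i n] assms(3)
    by fastforce
qed

lemma d_partition_extend:
  assumes "d > 0" "d_partition d s t n p" "u - t \<ge> d"
  shows "d_partition d s u (Suc n) (p(Suc n := u))"
  using assms by (auto simp: d_partition_def le_Suc_eq)

lemma bdd_above_d_variation_sums:
  fixes f :: "real \<Rightarrow> real"
  assumes "d > 0" "bounded (f ` {s..t})"
  shows "bdd_above {(\<Sum>i=1..n. \<bar>f (p i) - f (p (i - 1))\<bar>) | n p. d_partition d s t n p}"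
proof -
  obtain B where B: "\<And>x. x \<in> {s..t} \<Longrightarrow> \<bar>f x\<bar> \<le> B"
    using assms(2) unfolding bounded_real by (meson imageI)
  \<comment> \<open>At most \<open>(t - s) / d\<close> summands, each at most \<open>2 * B\<close>
    by the triangle inequality.\<close>
  have "(\<Sum>i=1..n. \<bar>f (p i) - f (p (i - 1))\<bar>) \<le> (t - s) / d * (2 * B)"
    if P: "d_partition d s t n p" for n p
  proof -
    \<comment> \<open>The bound \<open>B\<close> says nothing on an empty interval; the partition
      supplies a point of \<open>{s..t}\<close>, which forces \<open>B\<close> to be
      nonnegative.\<close>
    have "s \<in> {s..t}"
      using d_partition_mem[OF assms(1) P, of 0] P by (auto simp: d_partition_def)
    with B have "B \<ge> 0" by fastforce
    have "(\<Sum>i=1..n. \<bar>f (p i) - f (p (i - 1))\<bar>) \<le> (\<Sum>i=1..n. 2 * B)"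
    proof (rule sum_mono)
      fix i assume "i \<in> {1..n}"
      then have "i \<le> n" "i - 1 \<le> n" by auto
      then have "\<bar>f (p i)\<bar> \<le> B" "\<bar>f (p (i - 1))\<bar> \<le> B"
        by (intro B d_partition_mem[OF assms(1) P]; simp)+
      then show "\<bar>f (p i) - f (p (i - 1))\<bar> \<le> 2 * B" by linarith
    qed
    also have "\<dots> = real n * (2 * B)" by simp
    also have "\<dots> \<le> (t - s) / d * (2 * B)"
    proof (rule mult_right_mono)
      have "real n * d \<le> t - s"
        using d_partition_gap[OF P, of 0 n] P by (simp add: d_partition_def)
      with \<open>d > 0\<close> show "real n \<le> (t - s) / d" by (simp add: field_simps)
    qed (use \<open>B \<ge> 0\<close> in simp)
    finally show ?thesis .
  qed
  then show ?thesis by (auto intro!: bdd_aboveI)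
qed

lemma total_d_variation_upper:
  assumes "d > 0" "bounded (f ` {s..t})" "d_partition d s t n p"
  shows "(\<Sum>i=1..n. \<bar>f (p i) - f (p (i - 1))\<bar>) \<le> total_d_variation d s t f"
  unfolding total_d_variation_def
  by (rule cSup_upper[OF _ bdd_above_d_variation_sums[OF assms(1,2)]]) (use assms(3) in blast)

text \<open>The one-step partition shows that the set of sums is nonempty, as
  \<open>cSup_least\<close> requires, and its sum is a nonnegative lower bound for the
  supremum.\<close>

lemma d_partition_trivial:
  assumes "d > 0" "t - s \<ge> d"
  shows "d_partition d s t 1 (\<lambda>i. if i = 0 then s else t)"
  using assms by (auto simp: d_partition_def)

lemma total_d_variation_nonneg:
  assumes "d > 0" "bounded (f ` {s..t})" "t - s \<ge> d"
  shows "0 \<le> total_d_variation d s t f"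
  by (rule order_trans[OF _ total_d_variation_upper[OF assms(1,2) d_partition_trivial[OF assms(1,3)]]])
    (simp add: sum_nonneg)

lemma total_d_variation_mono:
  assumes "d > 0" "bounded (f ` {s..u})" "t - s \<ge> d" "u - t \<ge> d"
  shows "total_d_variation d s t f \<le> total_d_variation d s u f"
proof -
  have "(\<Sum>i=1..n. \<bar>f (p i) - f (p (i - 1))\<bar>) \<le> total_d_variation d s u f"
    if P: "d_partition d s t n p" for n p
  proof -
    let ?q = "p(Suc n := u)"
    \<comment> \<open>The update at \<open>Suc n\<close> leaves the values on \<open>{0..n}\<close>
      unchanged, so the old sum is the new one without its last term.\<close>
    have "(\<Sum>i=1..n. \<bar>f (p i) - f (p (i - 1))\<bar>) = (\<Sum>i=1..n. \<bar>f (?q i) - f (?q (i - 1))\<bar>)"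
      by (rule sum.cong) auto
    also have "\<dots> \<le> (\<Sum>i=1..Suc n. \<bar>f (?q i) - f (?q (i - 1))\<bar>)"
      by (rule sum_mono2) auto
    also have "\<dots> \<le> total_d_variation d s u f"
      by (rule total_d_variation_upper[OF assms(1,2) d_partition_extend[OF assms(1) P assms(4)]])
    finally show ?thesis .
  qed
  then show ?thesis
    unfolding total_d_variation_def[of d s t]
    by (intro cSup_least) (use d_partition_trivial[OF assms(1,3)] in blast)+
qed

theorem proposition4p1:
  fixes d a b :: real and f :: "real \<Rightarrow> real"
  assumes "d > 0"
    and "b - a \<ge> 2 * d"
    and "bounded (f ` {a..b})"
  shows "d_periodically_increasing d {a..b} (d_variation_function d a f)"
  unfolding d_periodically_increasing_def
proof (intro ballI impI)
  fix x y assume xy: "x \<in> {a..b}" "y \<in> {a..b}" "y - x \<ge> d"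
  have bdd: "bounded (f ` {a..y})"
    by (rule bounded_subset[OF assms(3)]) (use xy in auto)
  \<comment> \<open>Since \<open>y\<close> \<ge> \<open>x + d\<close> \<ge> \<open>a + d\<close>,
    the value at \<open>y\<close> is never the default \<open>0\<close>.\<close>
  have v: "d_variation_function d a f y = total_d_variation d a y f"
    using xy by (simp add: d_variation_function_def)
  show "d_variation_function d a f x \<le> d_variation_function d a f y"
  \<comment> \<open>Below \<open>a + d\<close> the value at \<open>x\<close> is \<open>0\<close> and
    nonnegativity suffices; otherwise \<open>x - a\<close> \<ge> \<open>d\<close> and monotonicity
    of the supremum applies.\<close>
  proof (cases "x < a + d")
    case True
    then show ?thesis
      unfolding v using total_d_variation_nonneg[OF assms(1) bdd] xy
      by (simp add: d_variation_function_def)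
  next
    case False
    then show ?thesis
      unfolding v using total_d_variation_mono[OF assms(1) bdd, of x] xy
      by (simp add: d_variation_function_def)
  qed
qed

end
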